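(* The axiomatic system $\mathbf{K_F}$ is complete with respect to the class of all EGL-models: for every formula $\varphi$, if $\vDash\varphi$ (i.e. $V_s(\varphi)=1$ for every EGL-model $M=(S,(r_a)_{a\in\mathcal A},\pi)$ and every $s\in S$), then $\vdash_{\mathbf{K_F}}\varphi$.
   Context: Fix a set $\mathcal P$ of atomic propositions and a set $\mathcal A$ of agents. Formulas: $\varphi ::= p \mid \bot \mid \varphi\wedge\varphi \mid \varphi\to\varphi \mid B_a\varphi$ with $p\in\mathcal P$, $a\in\mathcal A$. Abbreviations: $\neg\varphi=\varphi\to\bot$, $\varphi\vee\psi=((\varphi\to\psi)\to\psi)\wedge((\psi\to\varphi)\to\varphi)$, $\varphi\leftrightarrow\psi=(\varphi\to\psi)\wedge(\psi\to\varphi)$. An EGL-model (model) is $M=(S,(r_a)_{a\in\mathcal A},\pi)$ where $S$ is a non-empty countable set of states, each $r_a:S\times S\to[0,1]$, and $\pi:S\times\mathcal P\to[0,1]$. The value $V_s(\varphi)\in[0,1]$ is defined by: $V_s(p)=\pi(s,p)$; $V_s(\bot)=0$; $V_s(\varphi\wedge\psi)=\min\{V_s(\varphi),V_s(\psi)\}$; $V_s(\varphi\to\psi)=1$ if $V_s(\varphi)\le V_s(\psi)$ and $=V_s(\psi)$ otherwise; $V_s(B_a\varphi)=\inf_{s'\in S}\max\{1-r_a(s,s'),V_{s'}(\varphi)\}$. A formula is valid, $\vDash\varphi$, if $V_s(\varphi)=1$ in every model and at every state. $\mathbf{K_F}$ has as axioms (A) all instances (in this language) of tautologies of propositional Gödel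 logic and (K) $B_a(\varphi\to\psi)\to(B_a\varphi\to B_a\psi)$, and as rules (R1) modus ponens and (R2) from $\varphi$ infer $B_a\varphi$. $\vdash_{\mathbf{K_F}}\varphi$ means there is a finite sequence of formulas ending in $\varphi$ each of which is an axiom or is obtained from earlier ones by (R1) or (R2), with the restriction that (R2) cannot be applied to non-valid formulas. *)

theory Defs
  imports Complex_Main "HOL-Library.Countable_Set"
begin

datatype ('p, 'a) fm =
    Atom 'p
  | Falsum  (\<open>\<^bold>\<bottom>\<close>)
  | Conj "('p, 'a) fm" "('p, 'a) fm"  (infixr \<open>\<^bold>\<and>\<close> 35)
  | Imp "('p, 'a) fm" "('p, 'a) fm"  (infixr \<open>\<^bold>\<rightarrow>\<close> 25)
  | Bel 'a "('p, 'a) fm"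

definition goedel_imp :: "real \<Rightarrow> real \<Rightarrow> real" where
  "goedel_imp x y = (if x \<le> y then 1 else y)"

record ('s, 'p, 'a) model =
  states :: "'s set"
  acc :: "'a \<Rightarrow> 's \<Rightarrow> 's \<Rightarrow> real"
  val :: "'s \<Rightarrow> 'p \<Rightarrow> real"

definition egl_model :: "('s, 'p, 'a) model \<Rightarrow> bool" where
  "egl_model M \<longleftrightarrow>
     states M \<noteq> {} \<and> countable (states M) \<and>
     (\<forall>a. \<forall>s\<in>states M. \<forall>t\<in>states M. 0 \<le> acc M a s t \<and> acc M a s t \<le> 1) \<and>
     (\<forall>s\<in>states M. \<forall>p. 0 \<le> val M s p \<and> val M s p \<le> 1)"

primrec V :: "('s, 'p, 'a) model \<Rightarrow> 's \<Rightarrow> ('p, 'a) fm \<Rightarrow> real" where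
  "V M s (Atom p) = val M s p"
| "V M s \<^bold>\<bottom> = 0"
| "V M s (\<phi> \<^bold>\<and> \<psi>) = min (V M s \<phi>) (V M s \<psi>)"
| "V M s (\<phi> \<^bold>\<rightarrow> \<psi>) = goedel_imp (V M s \<phi>) (V M s \<psi>)"
| "V M s (Bel a \<phi>) = (INF t\<in>states M. max (1 - acc M a s t) (V M t \<phi>))"

text \<open>
  HOL cannot quantify over all state types inside a formula.  State sets are countable, so
  every model is isomorphic to one whose state set is a nonempty subset of the natural
  numbers; the lemma \<open>valid_any_states\<close> below shows that quantifying over these
  covers models over arbitrary state types.
\<close>

definition valid :: "('p, 'a) fm \<Rightarrow> bool"  (\<open>\<Turnstile> _\<close> [55] 55) where
  "\<Turnstile> \<phi> \<longleftrightarrow>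
     (\<forall>M :: (nat, 'p, 'a) model. egl_model M \<longrightarrow> (\<forall>s\<in>states M. V M s \<phi> = 1))"

lemma valid_any_states:
  fixes M :: "('s, 'p, 'a) model" and \<phi> :: "('p, 'a) fm"
  assumes "\<Turnstile> \<phi>" and M: "egl_model M" and s: "s \<in> states M"
  shows "V M s \<phi> = 1"
proof -
  define f where "f = to_nat_on (states M)"
  define g where "g = from_nat_into (states M)"
  have c: "countable (states M)" using M by (simp add: egl_model_def)
  have gf: "g (f t) = t" if "t \<in> states M" for t
    using c that by (simp add: f_def g_def)
  define N :: "(nat, 'p, 'a) model" where
    "N = \<lparr>states = f ` states M, acc = (\<lambda>a m n. acc M a (g m) (g n)), val = (\<lambda>m. val M (g m))\<rparr>"
  have N: "egl_model N"
    using M gf by (auto simp: egl_model_def N_def)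
  have "V N (f t) \<psi> = V M t \<psi>" if "t \<in> states M" for t and \<psi> :: "('p, 'a) fm"
    using that
  proof (induction \<psi> arbitrary: t)
    case (Bel a \<psi>)
    have "(\<lambda>u. max (1 - acc N a (f t) u) (V N u \<psi>)) ` states N
        = (\<lambda>u. max (1 - acc N a (f t) (f u)) (V N (f u) \<psi>)) ` states M"
      by (simp add: N_def image_image)
    also have "\<dots> = (\<lambda>u. max (1 - acc M a t u) (V M u \<psi>)) ` states M"
      using Bel by (intro image_cong) (simp_all add: N_def gf)
    finally show ?case by simp
  qed (simp_all add: N_def gf)
  moreover have "f s \<in> states N" using s by (simp add: N_def)
  ultimately show ?thesis using assms(1) N s unfolding valid_def by metis
qed

datatype gprop = GVar nat | GFalsum | GConj gprop gprop | GImp gprop gprop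

primrec geval :: "(nat \<Rightarrow> real) \<Rightarrow> gprop \<Rightarrow> real" where
  "geval e (GVar i) = e i"
| "geval e GFalsum = 0"
| "geval e (GConj A B) = min (geval e A) (geval e B)"
| "geval e (GImp A B) = goedel_imp (geval e A) (geval e B)"

definition goedel_tautology :: "gprop \<Rightarrow> bool" where
  "goedel_tautology A \<longleftrightarrow> (\<forall>e. (\<forall>i. 0 \<le> e i \<and> e i \<le> 1) \<longrightarrow> geval e A = 1)"

primrec inst :: "(nat \<Rightarrow> ('p, 'a) fm) \<Rightarrow> gprop \<Rightarrow> ('p, 'a) fm" where
  "inst \<sigma> (GVar i) = \<sigma> i"
| "inst \<sigma> GFalsum = \<^bold>\<bottom>"
| "inst \<sigma> (GConj A B) = (inst \<sigma> A \<^bold>\<and> inst \<sigma> B)"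
| "inst \<sigma> (GImp A B) = (inst \<sigma> A \<^bold>\<rightarrow> inst \<sigma> B)"

inductive KF_axiom :: "('p, 'a) fm \<Rightarrow> bool" where
  A: "goedel_tautology A \<Longrightarrow> KF_axiom (inst \<sigma> A)"
| K: "KF_axiom (Bel a (\<phi> \<^bold>\<rightarrow> \<psi>) \<^bold>\<rightarrow> (Bel a \<phi> \<^bold>\<rightarrow> Bel a \<psi>))"

definition KF_proof :: "('p, 'a) fm list \<Rightarrow> bool" where
  "KF_proof \<Phi> \<longleftrightarrow>
     (\<forall>i<length \<Phi>.
        KF_axiom (\<Phi> ! i) \<or>
        (\<exists>j<i. \<exists>k<i. \<Phi> ! k = (\<Phi> ! j \<^bold>\<rightarrow> \<Phi> ! i)) \<or>
        (\<exists>j<i. \<exists>a. \<Phi> ! i = Bel a (\<Phi> ! j) \<and> \<Turnstile> \<Phi> ! j))"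

definition KF_provable :: "('p, 'a) fm \<Rightarrow> bool"  (\<open>\<turnstile>\<^sub>K\<^sub>F _\<close> [55] 55) where
  "\<turnstile>\<^sub>K\<^sub>F \<phi> \<longleftrightarrow> (\<exists>\<Phi>. \<Phi> \<noteq> [] \<and> KF_proof \<Phi> \<and> last \<Phi> = \<phi>)"

end

theory Submission
  imports Defs
begin

text \<open>
  Suppose \<open>\<phi>\<^sub>0\<close> is not provable.  Goedel implication is preserved when all values above a
  threshold \<open>d < 1\<close> are collapsed to 1 and the others are scaled by a small positive factor, so
  an unprovable \<open>\<psi>\<^sub>1 \<rightarrow> \<dots> \<rightarrow> \<psi>\<^sub>n \<rightarrow> \<phi>\<close> has a propositional valuation, treating belief formulas
  as atoms, in which every \<open>\<psi>\<^sub>i\<close> is 1 and \<open>\<phi>\<close> is arbitrarily close to 0.  Only finitely many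
  theorems, about subformulas of \<open>\<phi>\<^sub>0\<close>, have to be respected by the valuations.  The
  countermodel is a tree of such valuations: if a world \<open>v\<close> gives \<open>B\<^sub>a \<phi>\<close> the value
  \<open>\<alpha> < 1\<close>, it gets successors with \<open>r\<^sub>a = 1 - \<alpha>\<close> in which \<open>\<phi>\<close> is at most \<open>1 / (n + 1)\<close> and
  every \<open>\<psi>\<close> with \<open>v(B\<^sub>a \<psi>) > \<alpha>\<close> is 1.  They exist by (K) and (R2), and they make the infimum
  defining \<open>B\<^sub>a \<phi>\<close> equal to \<open>\<alpha>\<close>.
\<close>

section \<open>Derivability and soundness\<close>

text \<open>The positions in a derivation matter only through the set of earlier formulas.
  Monotonicity in that set makes concatenation and extension of derivations immediate.\<close>

definition KF_step :: "('p, 'a) fm set \<Rightarrow> ('p, 'a) fm \<Rightarrow> bool" where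
  "KF_step X \<chi> \<longleftrightarrow> KF_axiom \<chi> \<or> (\<exists>\<psi>\<in>X. (\<psi> \<^bold>\<rightarrow> \<chi>) \<in> X) \<or> (\<exists>\<psi>\<in>X. \<exists>a. \<chi> = Bel a \<psi> \<and> \<Turnstile> \<psi>)"

lemma KF_step_mono: "KF_step X \<chi> \<Longrightarrow> X \<subseteq> Y \<Longrightarrow> KF_step Y \<chi>"
  unfolding KF_step_def by blast

lemma KF_proof_iff: "KF_proof xs \<longleftrightarrow> (\<forall>i<length xs. KF_step (set (take i xs)) (xs ! i))"
proof -
  have mem: "\<chi> \<in> set (take i xs) \<longleftrightarrow> (\<exists>j<i. xs ! j = \<chi>)" if "i < length xs" for i \<chi>
    using that by (auto simp: in_set_conv_nth)
  have "KF_step (set (take i xs)) (xs ! i) \<longleftrightarrow>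
        KF_axiom (xs ! i) \<or>
        (\<exists>j<i. \<exists>k<i. xs ! k = (xs ! j \<^bold>\<rightarrow> xs ! i)) \<or>
        (\<exists>j<i. \<exists>a. xs ! i = Bel a (xs ! j) \<and> \<Turnstile> xs ! j)" if "i < length xs" for i
    unfolding KF_step_def Bex_def mem[OF that] by blast
  then show ?thesis unfolding KF_proof_def by blast
qed

lemma KF_proof_append:
  assumes "KF_proof xs" "KF_proof ys"
  shows "KF_proof (xs @ ys)"
  unfolding KF_proof_iff
proof (intro allI impI)
  fix i assume i: "i < length (xs @ ys)"
  show "KF_step (set (take i (xs @ ys))) ((xs @ ys) ! i)"
  proof (cases "i < length xs")
    case True
    then show ?thesis using assms(1) by (simp add: KF_proof_iff nth_append)
  next
    case False
    then have "KF_step (set (take (i - length xs) ys)) (ys ! (i - length xs))"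
      using assms(2) i by (simp add: KF_proof_iff)
    then show ?thesis using False by (auto simp: nth_append elim: KF_step_mono)
  qed
qed

lemma KF_proof_snoc: "KF_proof xs \<Longrightarrow> KF_step (set xs) \<chi> \<Longrightarrow> KF_proof (xs @ [\<chi>])"
  unfolding KF_proof_iff by (simp add: less_Suc_eq nth_append)

lemma KF_provable_axiom: "KF_axiom \<chi> \<Longrightarrow> \<turnstile>\<^sub>K\<^sub>F \<chi>"
  unfolding KF_provable_def by (rule exI[of _ "[\<chi>]"]) (simp add: KF_proof_def)

lemma KF_provable_mp:
  assumes "\<turnstile>\<^sub>K\<^sub>F (\<psi> \<^bold>\<rightarrow> \<chi>)" "\<turnstile>\<^sub>K\<^sub>F \<psi>"
  shows "\<turnstile>\<^sub>K\<^sub>F \<chi>"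
proof -
  obtain xs ys where xs: "xs \<noteq> []" "KF_proof xs" "last xs = (\<psi> \<^bold>\<rightarrow> \<chi>)" "ys \<noteq> []" "KF_proof ys" "last ys = \<psi>"
    using assms unfolding KF_provable_def by blast
  then have "KF_step (set (xs @ ys)) \<chi>"
    unfolding KF_step_def by (metis UnI1 UnI2 last_in_set set_append)
  with xs have "KF_proof ((xs @ ys) @ [\<chi>])"
    by (intro KF_proof_snoc KF_proof_append)
  then show ?thesis unfolding KF_provable_def by (intro exI[of _ "(xs @ ys) @ [\<chi>]"] conjI) simp_all
qed

section \<open>Soundness\<close>

lemma egl_V_bounds:
  assumes "egl_model M" "s \<in> states M"
  shows "0 \<le> V M s \<chi> \<and> V M s \<chi> \<le> 1"
  using assms(2)
proof (induction \<chi> arbitrary: s)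
  case (Bel a \<chi>)
  let ?f = "\<lambda>t. max (1 - acc M a s t) (V M t \<chi>)"
  have b: "0 \<le> ?f t" "?f t \<le> 1" if "t \<in> states M" for t
    using assms(1) Bel that unfolding egl_model_def by (auto simp: le_max_iff_disj)
  have "(INF t\<in>states M. ?f t) \<le> ?f s"
    using b Bel.prems by (intro cINF_lower bdd_belowI2) auto
  moreover have "0 \<le> (INF t\<in>states M. ?f t)"
    using b Bel.prems by (intro cINF_greatest) auto
  ultimately show ?case using b[OF Bel.prems] by auto
qed (use assms(1) in \<open>auto simp: egl_model_def goedel_imp_def min_def\<close>)

lemma V_inst: "V M s (inst \<sigma> A) = geval (\<lambda>i. V M s (\<sigma> i)) A"
  by (induction A) auto

lemma V_Bel_le:
  assumes "egl_model M" "s \<in> states M" "t \<in> states M"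
  shows "V M s (Bel a \<chi>) \<le> max (1 - acc M a s t) (V M t \<chi>)"
proof -
  have "bdd_below ((\<lambda>t. max (1 - acc M a s t) (V M t \<chi>)) ` states M)"
    using egl_V_bounds[OF assms(1)] by (intro bdd_belowI2[where m=0]) (auto simp: le_max_iff_disj)
  then show ?thesis using assms(3) by (auto intro: cINF_lower)
qed

lemma V_K:
  assumes M: "egl_model M" and s: "s \<in> states M"
  shows "V M s (Bel a (\<phi> \<^bold>\<rightarrow> \<psi>) \<^bold>\<rightarrow> (Bel a \<phi> \<^bold>\<rightarrow> Bel a \<psi>)) = 1"
proof -
  let ?m = "min (V M s (Bel a (\<phi> \<^bold>\<rightarrow> \<psi>))) (V M s (Bel a \<phi>))"
  have "?m \<le> max (1 - acc M a s t) (V M t \<psi>)" if t: "t \<in> states M" for t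
    using V_Bel_le[OF M s t, of a "\<phi> \<^bold>\<rightarrow> \<psi>"] V_Bel_le[OF M s t, of a \<phi>]
    by (auto simp: goedel_imp_def split: if_splits)
  then have "?m \<le> V M s (Bel a \<psi>)"
    using s by (auto intro: cINF_greatest)
  then show ?thesis
    \<comment> \<open>If the inner implication has value 1, the outer one needs its antecedent to be
      at most 1; otherwise the bound on \<open>?m\<close> applies to the antecedent.\<close>
    using egl_V_bounds[OF M s, of "Bel a (\<phi> \<^bold>\<rightarrow> \<psi>)"]
    by (auto simp: goedel_imp_def simp del: V.simps(5))
qed

lemma KF_axiom_valid: "KF_axiom \<chi> \<Longrightarrow> \<Turnstile> \<chi>"
  unfolding valid_def
proof (induction rule: KF_axiom.induct)
  case (A A \<sigma>)
  then show ?case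
    by (auto simp: V_inst goedel_tautology_def egl_V_bounds)
next
  case (K a \<phi> \<psi>)
  show ?case using V_K by (intro allI impI ballI)
qed

lemma valid_mp:
  assumes "\<Turnstile> (\<psi> \<^bold>\<rightarrow> \<chi>)" "\<Turnstile> \<psi>"
  shows "\<Turnstile> \<chi>"
  unfolding valid_def
proof (intro allI impI ballI)
  fix M :: "(nat, 'a, 'b) model" and s assume M: "egl_model M" and s: "s \<in> states M"
  have "V M s (\<psi> \<^bold>\<rightarrow> \<chi>) = 1" "V M s \<psi> = 1"
    using assms M s unfolding valid_def by blast+
  then show "V M s \<chi> = 1"
    using egl_V_bounds[OF M s, of \<chi>] by (auto simp: goedel_imp_def split: if_splits)
qed

lemma valid_Bel:
  assumes "\<Turnstile> \<psi>"
  shows "\<Turnstile> Bel a \<psi>"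
  unfolding valid_def
proof (intro allI impI ballI)
  fix M :: "(nat, 'a, 'b) model" and s assume M: "egl_model M" and s: "s \<in> states M"
  have "1 \<le> V M s (Bel a \<psi>)"
    using assms M s by (auto simp: valid_def intro!: cINF_greatest)
  then show "V M s (Bel a \<psi>) = 1" using egl_V_bounds[OF M s] by (meson order_antisym)
qed

text \<open>Soundness serves completeness here: (R2) accepts only valid formulas, and since theorems
  are valid, \<open>KF_provable_Bel\<close> may apply it to every theorem.\<close>

lemma KF_sound:
  assumes "\<turnstile>\<^sub>K\<^sub>F \<chi>"
  shows "\<Turnstile> \<chi>"
proof -
  obtain xs where xs: "xs \<noteq> []" "KF_proof xs" "last xs = \<chi>"
    using assms unfolding KF_provable_def by blast
  have "\<Turnstile> (xs ! i)" if "i < length xs" for i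
    using that
  proof (induction i rule: less_induct)
    case (less i)
    then consider "KF_axiom (xs ! i)" | j k where "j < i" "k < i" "xs ! k = (xs ! j \<^bold>\<rightarrow> xs ! i)"
      | j a where "j < i" "xs ! i = Bel a (xs ! j)" "\<Turnstile> xs ! j"
      using xs(2) unfolding KF_proof_def by blast
    then show ?case
    proof cases
      case 1
      then show ?thesis by (rule KF_axiom_valid)
    next
      case (2 j k)
      then have "\<Turnstile> xs ! k" "\<Turnstile> xs ! j" using less.IH less.prems by (meson less_trans)+
      then show ?thesis using 2(3) valid_mp by metis
    next
      case 3
      then show ?thesis using valid_Bel by metis
    qed
  qed
  from this[of "length xs - 1"] show ?thesis using xs by (simp add: last_conv_nth)
qed

lemma KF_provable_Bel:
  assumes "\<turnstile>\<^sub>K\<^sub>F \<psi>"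
  shows "\<turnstile>\<^sub>K\<^sub>F Bel a \<psi>"
proof -
  obtain xs where xs: "xs \<noteq> []" "KF_proof xs" "last xs = \<psi>"
    using assms unfolding KF_provable_def by blast
  then have "KF_step (set xs) (Bel a \<psi>)"
    unfolding KF_step_def using KF_sound[OF assms] last_in_set by blast
  with xs have "KF_proof (xs @ [Bel a \<psi>])"
    by (intro KF_proof_snoc)
  then show ?thesis unfolding KF_provable_def by (intro exI[of _ "xs @ [Bel a \<psi>]"] conjI) simp_all
qed

section \<open>Iterated implications under belief\<close>

abbreviation imps :: "('p, 'a) fm list \<Rightarrow> ('p, 'a) fm \<Rightarrow> ('p, 'a) fm" where
  "imps \<psi>s \<phi> \<equiv> foldr Imp \<psi>s \<phi>"

text \<open>Each premise costs one use of (K), which is chained with the induction hypothesis by the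
  Goedel tautology (p \<rightarrow> (q \<rightarrow> r)) \<rightarrow> ((r \<rightarrow> s)
  \<rightarrow> (p \<rightarrow> (q \<rightarrow> s))).\<close>

lemma KF_provable_imps_Bel: "\<turnstile>\<^sub>K\<^sub>F (Bel a (imps \<psi>s \<phi>) \<^bold>\<rightarrow> imps (map (Bel a) \<psi>s) (Bel a \<phi>))"
proof (induction \<psi>s)
  case Nil
  have "goedel_tautology (GImp (GVar 0) (GVar 0))"
    by (simp add: goedel_tautology_def goedel_imp_def)
  from KF_axiom.A[OF this, of "\<lambda>_. Bel a \<phi>"] show ?case
    by (intro KF_provable_axiom) simp
next
  case (Cons \<psi> \<psi>s)
  let ?A = "Bel a (\<psi> \<^bold>\<rightarrow> imps \<psi>s \<phi>)" and ?B = "Bel a \<psi>" and ?C = "Bel a (imps \<psi>s \<phi>)"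
    and ?D = "imps (map (Bel a) \<psi>s) (Bel a \<phi>)"
  let ?\<sigma> = "\<lambda>i::nat. if i = 0 then ?A else if i = 1 then ?B else if i = 2 then ?C else ?D"
  have "goedel_tautology (GImp (GImp (GVar 0) (GImp (GVar 1) (GVar 2)))
      (GImp (GImp (GVar 2) (GVar 3)) (GImp (GVar 0) (GImp (GVar 1) (GVar 3)))))"
    by (auto simp: goedel_tautology_def goedel_imp_def)
  from KF_axiom.A[OF this, of ?\<sigma>]
  have "\<turnstile>\<^sub>K\<^sub>F ((?A \<^bold>\<rightarrow> (?B \<^bold>\<rightarrow> ?C)) \<^bold>\<rightarrow> ((?C \<^bold>\<rightarrow> ?D) \<^bold>\<rightarrow> (?A \<^bold>\<rightarrow> (?B \<^bold>\<rightarrow> ?D))))"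
    by (intro KF_provable_axiom) simp
  from KF_provable_mp[OF KF_provable_mp[OF this KF_provable_axiom[OF KF_axiom.K]] Cons.IH]
  have "\<turnstile>\<^sub>K\<^sub>F (?A \<^bold>\<rightarrow> (?B \<^bold>\<rightarrow> ?D))" .
  then show ?case by simp
qed

lemma KF_provable_imps_mp:
  assumes "\<turnstile>\<^sub>K\<^sub>F imps \<psi>s \<phi>" "\<And>\<psi>. \<psi> \<in> set \<psi>s \<Longrightarrow> \<turnstile>\<^sub>K\<^sub>F \<psi>"
  shows "\<turnstile>\<^sub>K\<^sub>F \<phi>"
  using assms by (induction \<psi>s) (auto intro: KF_provable_mp)

section \<open>Propositional valuations\<close>

primrec gext :: "(('p, 'a) fm \<Rightarrow> real) \<Rightarrow> ('p, 'a) fm \<Rightarrow> real" where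
  "gext v (Atom p) = v (Atom p)"
| "gext v \<^bold>\<bottom> = 0"
| "gext v (\<phi> \<^bold>\<and> \<psi>) = min (gext v \<phi>) (gext v \<psi>)"
| "gext v (\<phi> \<^bold>\<rightarrow> \<psi>) = goedel_imp (gext v \<phi>) (gext v \<psi>)"
| "gext v (Bel a \<phi>) = v (Bel a \<phi>)"

primrec primes :: "('p, 'a) fm \<Rightarrow> ('p, 'a) fm set" where
  "primes (Atom p) = {Atom p}"
| "primes \<^bold>\<bottom> = {}"
| "primes (\<phi> \<^bold>\<and> \<psi>) = primes \<phi> \<union> primes \<psi>"
| "primes (\<phi> \<^bold>\<rightarrow> \<psi>) = primes \<phi> \<union> primes \<psi>"
| "primes (Bel a \<phi>) = {Bel a \<phi>}"

primrec skeleton :: "(('p, 'a) fm \<Rightarrow> nat) \<Rightarrow> ('p, 'a) fm \<Rightarrow> gprop" where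
  "skeleton f (Atom p) = GVar (f (Atom p))"
| "skeleton f \<^bold>\<bottom> = GFalsum"
| "skeleton f (\<phi> \<^bold>\<and> \<psi>) = GConj (skeleton f \<phi>) (skeleton f \<psi>)"
| "skeleton f (\<phi> \<^bold>\<rightarrow> \<psi>) = GImp (skeleton f \<phi>) (skeleton f \<psi>)"
| "skeleton f (Bel a \<phi>) = GVar (f (Bel a \<phi>))"

lemma finite_primes: "finite (primes \<phi>)"
  by (induction \<phi>) auto

lemma geval_skeleton: "geval e (skeleton f \<phi>) = gext (\<lambda>\<psi>. e (f \<psi>)) \<phi>"
  by (induction \<phi>) auto

lemma inst_skeleton: "(\<And>\<psi>. \<psi> \<in> primes \<phi> \<Longrightarrow> \<sigma> (f \<psi>) = \<psi>) \<Longrightarrow> inst \<sigma> (skeleton f \<phi>) = \<phi>"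
  by (induction \<phi>) auto

definition unit_valued :: "('b \<Rightarrow> real) \<Rightarrow> bool" where
  "unit_valued v \<longleftrightarrow> (\<forall>x. 0 \<le> v x \<and> v x \<le> 1)"

lemma unit_valued_gext: "unit_valued v \<Longrightarrow> unit_valued (gext v)"
proof -
  assume v: "unit_valued v"
  have "0 \<le> gext v \<phi> \<and> gext v \<phi> \<le> 1" for \<phi>
    using v by (induction \<phi>) (auto simp: unit_valued_def goedel_imp_def)
  then show ?thesis by (simp add: unit_valued_def)
qed

lemma goedel_countervaluation:
  assumes "\<not> \<turnstile>\<^sub>K\<^sub>F \<phi>"
  obtains v where "unit_valued v" "gext v \<phi> < 1"
proof -
  \<comment> \<open>The type of formulas may be uncountable, so the numbering by propositional
    variables is injective only on the finitely many \<open>primes\<close> of \<phi>.\<close>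
  obtain f :: "('a, 'b) fm \<Rightarrow> nat" where f: "inj_on f (primes \<phi>)"
    using finite_imp_inj_to_nat_seg[OF finite_primes] by blast
  have "inst (inv_into (primes \<phi>) f) (skeleton f \<phi>) = \<phi>"
    using f by (intro inst_skeleton) simp
  then have "\<not> goedel_tautology (skeleton f \<phi>)"
    using assms KF_provable_axiom KF_axiom.A by metis
  then obtain e where e: "\<forall>i. 0 \<le> e i \<and> e i \<le> 1" "geval e (skeleton f \<phi>) \<noteq> 1"
    unfolding goedel_tautology_def by blast
  have "unit_valued (\<lambda>\<psi>. e (f \<psi>))" using e(1) by (simp add: unit_valued_def)
  moreover from this have "gext (\<lambda>\<psi>. e (f \<psi>)) \<phi> < 1"
    using e(2) unit_valued_gext by (metis geval_skeleton order_less_le unit_valued_def)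
  ultimately show ?thesis using that by blast
qed

section \<open>Collapsing values above a threshold\<close>

definition collapse :: "real \<Rightarrow> real \<Rightarrow> real \<Rightarrow> real" where
  "collapse d \<delta> x = (if x > d then 1 else \<delta> * x)"

text \<open>The map is strictly increasing up to d and stays below 1 there, then jumps to 1, and it
  fixes 0 and 1. Hence it commutes with the minimum and with Goedel implication: if x > y > d, both
  sides are 1, and if x > y with y \<le> d, the order stays strict.\<close>

lemma gext_collapse:
  assumes d: "0 \<le> d" "d < 1" and \<delta>: "0 < \<delta>" "\<delta> \<le> 1"
  shows "gext (\<lambda>\<psi>. collapse d \<delta> (v \<psi>)) \<phi> = collapse d \<delta> (gext v \<phi>)"
proof (induction \<phi>)
  have lt: "\<delta> * x < 1" if "x \<le> d" for x
  proof -
    have "\<delta> * x \<le> \<delta> * d" using that \<delta> by simp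
    also have "\<dots> \<le> 1 * d" using \<delta> d by (intro mult_right_mono)
    finally show ?thesis using d by simp
  qed
  case (Imp \<phi> \<psi>)
  then show ?case
    using lt[of "gext v \<phi>"] lt[of "gext v \<psi>"] d \<delta>
    by (auto simp: collapse_def goedel_imp_def)
next
  case (Conj \<phi> \<psi>)
  have "mono (collapse d \<delta>)"
  proof (rule monoI)
    fix x y :: real assume "x \<le> y"
    moreover have "\<delta> * x \<le> 1" if "x \<le> d"
      using mult_mono[of \<delta> 1 x 1] that d \<delta> mult_nonneg_nonpos[of \<delta> x] by (cases "x \<ge> 0") auto
    ultimately show "collapse d \<delta> x \<le> collapse d \<delta> y" using \<delta> by (auto simp: collapse_def)
  qed
  then show ?case using Conj by (simp add: min_of_mono)
qed (use d in \<open>auto simp: collapse_def\<close>)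

lemma gext_imps_less_one:
  assumes "gext v (imps \<psi>s \<phi>) < 1"
  shows "gext v (imps \<psi>s \<phi>) = gext v \<phi> \<and> (\<forall>\<psi>\<in>set \<psi>s. gext v \<phi> < gext v \<psi>)"
  using assms by (induction \<psi>s) (auto simp: goedel_imp_def split: if_splits)

lemma gext_imps_eq_one:
  assumes "gext v (imps \<psi>s \<phi>) = 1" "\<And>\<psi>. \<psi> \<in> set \<psi>s \<Longrightarrow> gext v \<phi> < gext v \<psi>"
  shows "gext v \<phi> = 1"
  using assms
proof (induction \<psi>s)
  case (Cons \<psi> \<psi>s)
  show ?case
  proof (rule ccontr)
    assume n: "gext v \<phi> \<noteq> 1"
    then have "gext v (imps \<psi>s \<phi>) \<noteq> 1" using Cons by auto
    \<comment> \<open>A chain of implications takes only the value of its conclusion or 1. The tail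
      is not 1, so it equals \<open>gext v \<phi>\<close>, which lies below the value of \<psi>; the
      whole chain is then below 1 as well.\<close>
    moreover have "gext v (imps xs \<phi>) = gext v \<phi> \<or> gext v (imps xs \<phi>) = 1" for xs
      by (induction xs) (auto simp: goedel_imp_def)
    ultimately show False
      using Cons.prems n by (auto simp: goedel_imp_def split: if_splits)
        (metis leD)
  qed
qed simp

text \<open>Theorems can be added as premises without making the implication provable. A
  countervaluation then puts all premises strictly above the conclusion, and collapsing at the value
  of the conclusion sends them to 1.\<close>

lemma small_countervaluation:
  assumes nd: "\<not> \<turnstile>\<^sub>K\<^sub>F imps \<psi>s \<phi>" and fin: "finite G" and G: "\<And>\<gamma>. \<gamma> \<in> G \<Longrightarrow> \<turnstile>\<^sub>K\<^sub>F \<gamma>"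
    and \<delta>: "0 < \<delta>" "\<delta> \<le> 1"
  obtains v where "unit_valued v" "\<And>\<gamma>. \<gamma> \<in> G \<union> set \<psi>s \<Longrightarrow> gext v \<gamma> = 1" "gext v \<phi> \<le> \<delta>" "gext v \<phi> < 1"
proof -
  obtain gs where gs: "set gs = G" using finite_list[OF fin] by blast
  have "\<not> \<turnstile>\<^sub>K\<^sub>F imps (gs @ \<psi>s) \<phi>"
    using nd G KF_provable_imps_mp[of gs "imps \<psi>s \<phi>"] by (auto simp: gs)
  then obtain v where v: "unit_valued v" "gext v (imps (gs @ \<psi>s) \<phi>) < 1"
    using goedel_countervaluation by blast
  define d where "d = gext v \<phi>"
  have d: "0 \<le> d" "d < 1" and gr: "\<And>\<gamma>. \<gamma> \<in> G \<union> set \<psi>s \<Longrightarrow> d < gext v \<gamma>"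
    using gext_imps_less_one[OF v(2)] v unit_valued_gext[OF v(1)]
    by (auto simp: d_def unit_valued_def gs)
  \<comment> \<open>The second bound keeps the new value of \<phi> below 1 even when \<delta> = 1,
    the case used for the root.\<close>
  have "\<delta> * d \<le> \<delta> * 1" "\<delta> * d \<le> 1 * d"
    using d \<delta> by (intro mult_left_mono mult_right_mono; simp)+
  then have d': "\<delta> * d \<le> \<delta>" "\<delta> * d < 1" using d by auto
  have b: "0 \<le> collapse d \<delta> x \<and> collapse d \<delta> x \<le> 1" if "0 \<le> x \<and> x \<le> 1" for x
    using that \<delta> by (auto simp: collapse_def mult_le_one)
  show ?thesis
  proof (rule that[of "\<lambda>\<psi>. collapse d \<delta> (v \<psi>)"])
    show "unit_valued (\<lambda>\<psi>. collapse d \<delta> (v \<psi>))"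
      using v(1) b unfolding unit_valued_def by simp
    show "gext (\<lambda>\<psi>. collapse d \<delta> (v \<psi>)) \<gamma> = 1" if "\<gamma> \<in> G \<union> set \<psi>s" for \<gamma>
      using gr[OF that] unfolding gext_collapse[OF d \<delta>] by (simp add: collapse_def)
    show "gext (\<lambda>\<psi>. collapse d \<delta> (v \<psi>)) \<phi> \<le> \<delta>" "gext (\<lambda>\<psi>. collapse d \<delta> (v \<psi>)) \<phi> < 1"
      unfolding gext_collapse[OF d \<delta>] using d' by (simp_all add: collapse_def flip: d_def)
  qed
qed

section \<open>The tree countermodel\<close>

primrec subfms :: "('p, 'a) fm \<Rightarrow> ('p, 'a) fm set" where
  "subfms (Atom p) = {Atom p}"
| "subfms \<^bold>\<bottom> = {\<^bold>\<bottom>}"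
| "subfms (\<phi> \<^bold>\<and> \<psi>) = insert (\<phi> \<^bold>\<and> \<psi>) (subfms \<phi> \<union> subfms \<psi>)"
| "subfms (\<phi> \<^bold>\<rightarrow> \<psi>) = insert (\<phi> \<^bold>\<rightarrow> \<psi>) (subfms \<phi> \<union> subfms \<psi>)"
| "subfms (Bel a \<phi>) = insert (Bel a \<phi>) (subfms \<phi>)"

lemma finite_subfms: "finite (subfms \<phi>)"
  by (induction \<phi>) auto

lemma subfms_refl: "\<phi> \<in> subfms \<phi>"
  by (cases \<phi>) auto

lemma subfms_trans: "\<psi> \<in> subfms \<phi> \<Longrightarrow> subfms \<psi> \<subseteq> subfms \<phi>"
  by (induction \<phi>) auto

definition bel_pairs :: "('p, 'a) fm \<Rightarrow> ('a \<times> ('p, 'a) fm) set" where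
  "bel_pairs \<phi>\<^sub>0 = {(a, \<phi>). Bel a \<phi> \<in> subfms \<phi>\<^sub>0}"

text \<open>These are the theorems that the existence of successors relies on. Distinctness bounds
  the length of the premise lists and so keeps the set finite.\<close>

definition bel_theorems :: "('p, 'a) fm \<Rightarrow> ('p, 'a) fm set" where
  "bel_theorems \<phi>\<^sub>0 =
     {\<chi>. \<turnstile>\<^sub>K\<^sub>F \<chi> \<and> (\<exists>a \<phi> \<psi>s. \<chi> = imps (map (Bel a) \<psi>s) (Bel a \<phi>) \<and> (a, \<phi>) \<in> bel_pairs \<phi>\<^sub>0 \<and>
        distinct \<psi>s \<and> set \<psi>s \<subseteq> subfms \<phi>\<^sub>0)}"

lemma finite_bel_pairs: "finite (bel_pairs \<phi>\<^sub>0)"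
proof -
  have "(\<lambda>(a, \<phi>). Bel a \<phi>) ` bel_pairs \<phi>\<^sub>0 \<subseteq> subfms \<phi>\<^sub>0" by (auto simp: bel_pairs_def)
  then show ?thesis
    by (rule inj_on_finite[OF _ _ finite_subfms, rotated]) (auto simp: inj_on_def)
qed

lemma finite_bel_theorems: "finite (bel_theorems \<phi>\<^sub>0)"
proof (rule finite_subset)
  show "bel_theorems \<phi>\<^sub>0 \<subseteq> (\<lambda>((a, \<phi>), \<psi>s). imps (map (Bel a) \<psi>s) (Bel a \<phi>)) `
      (bel_pairs \<phi>\<^sub>0 \<times> {\<psi>s. distinct \<psi>s \<and> set \<psi>s \<subseteq> subfms \<phi>\<^sub>0})"
    unfolding bel_theorems_def by force
  show "finite \<dots>"
    using finite_bel_pairs finite_subset_distinct[OF finite_subfms] by (auto simp: conj_commute)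
qed

section \<open>Worlds and their successors\<close>

definition world :: "('p, 'a) fm \<Rightarrow> (('p, 'a) fm \<Rightarrow> real) \<Rightarrow> bool" where
  "world \<phi>\<^sub>0 v \<longleftrightarrow> unit_valued v \<and> (\<forall>\<chi>\<in>bel_theorems \<phi>\<^sub>0. gext v \<chi> = 1)"

text \<open>The guard makes the requirement vacuous for irrelevant labels, so every label has a
  successor and \<open>tree\<close> can be defined on all lists.\<close>

definition succ_world ::
    "('p, 'a) fm \<Rightarrow> (('p, 'a) fm \<Rightarrow> real) \<Rightarrow> 'a \<Rightarrow> ('p, 'a) fm \<Rightarrow> nat \<Rightarrow> (('p, 'a) fm \<Rightarrow> real) \<Rightarrow> bool" where
  "succ_world \<phi>\<^sub>0 v a \<phi> n v' \<longleftrightarrow> world \<phi>\<^sub>0 v' \<and>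
     ((a, \<phi>) \<in> bel_pairs \<phi>\<^sub>0 \<and> v (Bel a \<phi>) < 1 \<longrightarrow>
       gext v' \<phi> \<le> 1 / real (Suc n) \<and>
       (\<forall>\<psi>. (a, \<psi>) \<in> bel_pairs \<phi>\<^sub>0 \<and> v (Bel a \<psi>) > v (Bel a \<phi>) \<longrightarrow> gext v' \<psi> = 1))"

text \<open>Let \<open>?T\<close> collect the formulas that must become 1. If they provably implied
  \<phi>, then (R2) and (K) would give a member of \<open>bel_theorems\<close> whose premises all
  lie above its conclusion \<open>Bel a \<phi>\<close> at v, forcing that conclusion to be 1. So a
  small countervaluation exists.\<close>

lemma succ_world_exists:
  assumes v: "world \<phi>\<^sub>0 v"
  shows "\<exists>v'. succ_world \<phi>\<^sub>0 v a \<phi> n v'"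
proof (cases "(a, \<phi>) \<in> bel_pairs \<phi>\<^sub>0 \<and> v (Bel a \<phi>) < 1")
  case True
  let ?T = "{\<psi>. (a, \<psi>) \<in> bel_pairs \<phi>\<^sub>0 \<and> v (Bel a \<psi>) > v (Bel a \<phi>)}"
  have sub: "?T \<subseteq> subfms \<phi>\<^sub>0"
  proof
    fix \<psi> assume "\<psi> \<in> ?T"
    then have "subfms (Bel a \<psi>) \<subseteq> subfms \<phi>\<^sub>0" by (intro subfms_trans) (simp add: bel_pairs_def)
    then show "\<psi> \<in> subfms \<phi>\<^sub>0" using subfms_refl by auto
  qed
  then have "finite ?T" using finite_subfms by (rule finite_subset)
  from finite_distinct_list[OF this] obtain \<psi>s where "set \<psi>s = ?T \<and> distinct \<psi>s" ..
  then have \<psi>s: "set \<psi>s = ?T" "distinct \<psi>s" by simp_all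
  have nd: "\<not> \<turnstile>\<^sub>K\<^sub>F imps \<psi>s \<phi>"
  proof
    assume "\<turnstile>\<^sub>K\<^sub>F imps \<psi>s \<phi>"
    then have "\<turnstile>\<^sub>K\<^sub>F imps (map (Bel a) \<psi>s) (Bel a \<phi>)"
      by (intro KF_provable_mp[OF KF_provable_imps_Bel] KF_provable_Bel)
    moreover have "set \<psi>s \<subseteq> subfms \<phi>\<^sub>0" using \<psi>s(1) sub by simp
    ultimately have "imps (map (Bel a) \<psi>s) (Bel a \<phi>) \<in> bel_theorems \<phi>\<^sub>0"
      unfolding bel_theorems_def using True \<psi>s(2) by blast
    then have "gext v (imps (map (Bel a) \<psi>s) (Bel a \<phi>)) = 1"
      using v unfolding world_def by blast
    moreover have "gext v (Bel a \<phi>) < gext v \<chi>" if \<chi>: "\<chi> \<in> set (map (Bel a) \<psi>s)" for \<chi>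
    proof -
      obtain \<psi> where "\<chi> = Bel a \<psi>" "\<psi> \<in> ?T" using \<chi> unfolding set_map \<psi>s(1) by blast
      then show ?thesis by simp
    qed
    ultimately have "gext v (Bel a \<phi>) = 1" by (rule gext_imps_eq_one)
    then show False using True by simp
  qed
  have thms: "\<turnstile>\<^sub>K\<^sub>F \<gamma>" if "\<gamma> \<in> bel_theorems \<phi>\<^sub>0" for \<gamma>
    using that by (simp add: bel_theorems_def)
  have \<delta>: "0 < 1 / real (Suc n)" "1 / real (Suc n) \<le> 1" by auto
  show ?thesis
  proof (rule small_countervaluation[OF nd finite_bel_theorems thms \<delta>])
    fix v' assume v': "unit_valued v'" "gext v' \<phi> \<le> 1 / real (Suc n)"
      and one: "\<And>\<gamma>. \<gamma> \<in> bel_theorems \<phi>\<^sub>0 \<union> set \<psi>s \<Longrightarrow> gext v' \<gamma> = 1"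
    have "world \<phi>\<^sub>0 v'" using v'(1) one by (simp add: world_def)
    moreover have "gext v' \<psi> = 1" if "\<psi> \<in> ?T" for \<psi>
      using that one \<psi>s(1) by (metis UnI2)
    ultimately show ?thesis using v'(2) unfolding succ_world_def by blast
  qed
\<comment> \<open>With a vacuous guard, v is its own successor.\<close>
qed (use v in \<open>auto simp: succ_world_def\<close>)

text \<open>A node is the list of labels on its path from the root, the latest label first.\<close>

primrec tree :: "('p, 'a) fm \<Rightarrow> (('p, 'a) fm \<Rightarrow> real) \<Rightarrow>
    (('a \<times> ('p, 'a) fm) \<times> nat) list \<Rightarrow> ('p, 'a) fm \<Rightarrow> real" where
  "tree \<phi>\<^sub>0 v [] = v"
| "tree \<phi>\<^sub>0 v (x # s) =
     (SOME v'. succ_world \<phi>\<^sub>0 (tree \<phi>\<^sub>0 v s) (fst (fst x)) (snd (fst x)) (snd x) v')"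

lemma succ_world_tree_Cons:
  assumes "world \<phi>\<^sub>0 (tree \<phi>\<^sub>0 v s)"
  shows "succ_world \<phi>\<^sub>0 (tree \<phi>\<^sub>0 v s) (fst (fst x)) (snd (fst x)) (snd x) (tree \<phi>\<^sub>0 v (x # s))"
  unfolding tree.simps by (rule someI_ex[OF succ_world_exists[OF assms]])

lemma world_tree: "world \<phi>\<^sub>0 v \<Longrightarrow> world \<phi>\<^sub>0 (tree \<phi>\<^sub>0 v s)"
proof (induction s)
  case (Cons x s)
  from succ_world_tree_Cons[OF Cons.IH[OF Cons.prems]] show ?case
    unfolding succ_world_def by blast
qed simp

lemma succ_world_tree:
  assumes "world \<phi>\<^sub>0 v"
  shows "succ_world \<phi>\<^sub>0 (tree \<phi>\<^sub>0 v s) a \<phi> n (tree \<phi>\<^sub>0 v (((a, \<phi>), n) # s))"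
  using succ_world_tree_Cons[OF world_tree[OF assms], of s "((a, \<phi>), n)"] by (simp only: fst_conv snd_conv)

section \<open>The model and its truth lemma\<close>

text \<open>Along an edge labelled by a and \<phi>, 1 - r is the prescribed value of
  \<open>Bel a \<phi>\<close>. One edge for each n is taken because \<phi> is only made small, not
  0, which matters when that value is 0.\<close>

definition tree_model :: "('p, 'a) fm \<Rightarrow> (('p, 'a) fm \<Rightarrow> real) \<Rightarrow>
    ((('a \<times> ('p, 'a) fm) \<times> nat) list, 'p, 'a) model" where
  "tree_model \<phi>\<^sub>0 v =
     \<lparr>states = lists (bel_pairs \<phi>\<^sub>0 \<times> UNIV),
      acc = (\<lambda>a s t. case t of [] \<Rightarrow> 0
         | ((b, \<phi>), n) # s' \<Rightarrow> if b = a \<and> s' = s then 1 - tree \<phi>\<^sub>0 v s (Bel a \<phi>) else 0),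
      val = (\<lambda>s p. tree \<phi>\<^sub>0 v s (Atom p))\<rparr>"

lemma tree_bounds: "world \<phi>\<^sub>0 v \<Longrightarrow> 0 \<le> tree \<phi>\<^sub>0 v s \<chi> \<and> tree \<phi>\<^sub>0 v s \<chi> \<le> 1"
  using world_tree by (metis unit_valued_def world_def)

lemma egl_tree_model:
  assumes "world \<phi>\<^sub>0 v"
  shows "egl_model (tree_model \<phi>\<^sub>0 v)"
proof -
  have "countable (bel_pairs \<phi>\<^sub>0)"
    using finite_bel_pairs countable_finite by blast
  then have "countable (lists (bel_pairs \<phi>\<^sub>0 \<times> (UNIV :: nat set)))"
    by (intro countable_lists countable_SIGMA) auto
  moreover have "[] \<in> lists (bel_pairs \<phi>\<^sub>0 \<times> (UNIV :: nat set))" by simp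
  ultimately show ?thesis
    using tree_bounds[OF assms]
    by (auto simp: egl_model_def tree_model_def split: list.splits)
qed

lemma tree_truth:
  assumes w: "world \<phi>\<^sub>0 v" and "\<chi> \<in> subfms \<phi>\<^sub>0" "s \<in> states (tree_model \<phi>\<^sub>0 v)"
  shows "V (tree_model \<phi>\<^sub>0 v) s \<chi> = gext (tree \<phi>\<^sub>0 v s) \<chi>"
  using assms(2,3)
proof (induction \<chi> arbitrary: s)
  case (Bel a \<phi>)
  let ?M = "tree_model \<phi>\<^sub>0 v"
  let ?\<alpha> = "tree \<phi>\<^sub>0 v s (Bel a \<phi>)"
  have p: "(a, \<phi>) \<in> bel_pairs \<phi>\<^sub>0" using Bel.prems by (simp add: bel_pairs_def)
  have "\<phi> \<in> subfms \<phi>\<^sub>0" using subfms_trans[OF Bel.prems(1)] subfms_refl by auto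
  then have IH: "V ?M t \<phi> = gext (tree \<phi>\<^sub>0 v t) \<phi>" if "t \<in> states ?M" for t
    using Bel.IH that by blast
  have "?\<alpha> \<le> V ?M s (Bel a \<phi>)"
  proof (simp only: V.simps, rule cINF_greatest)
    fix t assume t: "t \<in> states ?M"
    show "?\<alpha> \<le> max (1 - acc ?M a s t) (V ?M t \<phi>)"
    \<comment> \<open>On an a-edge made for \<psi>, the term is at least the value of
      \<open>Bel a \<psi>\<close>. If this is below \<alpha>, the successor condition gives \<phi>
      the value 1 at t. Everywhere else accessibility is 0 and the term is at least 1.\<close>
    proof (cases "\<exists>\<psi> n. t = ((a, \<psi>), n) # s")
      case True
      then obtain \<psi> n where t': "t = ((a, \<psi>), n) # s" by blast
      have "(a, \<psi>) \<in> bel_pairs \<phi>\<^sub>0" using t by (simp add: t' tree_model_def)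
      moreover have "succ_world \<phi>\<^sub>0 (tree \<phi>\<^sub>0 v s) a \<psi> n (tree \<phi>\<^sub>0 v t)"
        using succ_world_tree[OF w] by (simp only: t')
      moreover have "1 - acc ?M a s t = tree \<phi>\<^sub>0 v s (Bel a \<psi>)"
        by (simp add: t' tree_model_def)
      ultimately show ?thesis
        using p IH[OF t] tree_bounds[OF w, of s "Bel a \<phi>"] unfolding succ_world_def
        by (smt (verit))
    next
      case False
      then have "acc ?M a s t = 0"
        by (auto simp: tree_model_def split: list.splits)
      then show ?thesis using tree_bounds[OF w, of s "Bel a \<phi>"] by (simp add: le_max_iff_disj)
    qed
  qed (use Bel.prems in blast)
  moreover have "V ?M s (Bel a \<phi>) \<le> ?\<alpha>"
  proof (cases "?\<alpha> < 1")
    case True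
    show ?thesis
    proof (rule ccontr)
      assume gt: "\<not> ?thesis"
      then have "0 < V ?M s (Bel a \<phi>)" using tree_bounds[OF w, of s "Bel a \<phi>"] by linarith
      \<comment> \<open>The supposed excess over \<alpha> \<ge> 0 makes the belief value positive.
        The n-th successor for \<phi> contributes at most the maximum of \<alpha> and 1 / (n + 1),
        which is smaller.\<close>
      then obtain n where n: "1 / real (Suc n) < V ?M s (Bel a \<phi>)"
        using reals_Archimedean by (auto simp only: inverse_eq_divide)
      let ?t = "((a, \<phi>), n) # s"
      have t: "?t \<in> states ?M" using p Bel.prems by (simp add: tree_model_def)
      have "V ?M s (Bel a \<phi>) \<le> max (1 - acc ?M a s ?t) (V ?M ?t \<phi>)"
        by (rule V_Bel_le[OF egl_tree_model[OF w] Bel.prems(2) t])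
      moreover have "1 - acc ?M a s ?t = ?\<alpha>" by (simp add: tree_model_def)
      moreover have "V ?M ?t \<phi> \<le> 1 / real (Suc n)"
        using succ_world_tree[OF w, of s a \<phi> n] p True IH[OF t] by (auto simp only: succ_world_def)
      ultimately show False using gt n by linarith
    qed
  next
    case False
    then show ?thesis using egl_V_bounds[OF egl_tree_model[OF w] Bel.prems(2), of "Bel a \<phi>"] by linarith
  qed
  ultimately show ?case by (simp only: gext.simps order_antisym)
qed (use subfms_trans subfms_refl in \<open>fastforce simp: tree_model_def\<close>)+

theorem theorem4p2:
  fixes \<phi> :: "('p, 'a) fm"
  assumes "\<Turnstile> \<phi>"
  shows "\<turnstile>\<^sub>K\<^sub>F \<phi>"
proof (rule ccontr)
  assume "\<not> \<turnstile>\<^sub>K\<^sub>F \<phi>"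
  then have "\<not> \<turnstile>\<^sub>K\<^sub>F imps [] \<phi>" by simp
  \<comment> \<open>At the root, \<phi> need only be below 1, so \<delta> = 1 with no premises
    suffices.\<close>
  from small_countervaluation[OF this finite_bel_theorems, of \<phi> 1]
  obtain v where "unit_valued v" "\<And>\<gamma>. \<gamma> \<in> bel_theorems \<phi> \<Longrightarrow> gext v \<gamma> = 1" "gext v \<phi> < 1"
    by (auto simp: bel_theorems_def)
  then have w: "world \<phi> v" and less: "gext v \<phi> < 1" by (auto simp: world_def)
  have root: "[] \<in> states (tree_model \<phi> v)" by (simp add: tree_model_def)
  have "V (tree_model \<phi> v) [] \<phi> = gext v \<phi>"
    using tree_truth[OF w subfms_refl root] by simp
  then show False
    \<comment> \<open>The states are lists of labels, while validity is defined over
      \<open>nat\<close> states; countability bridges the two.\<close>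
    using valid_any_states[OF assms egl_tree_model[OF w] root] less by simp
qed

end
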